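(* For $n\in\mathbb N=\{0,1,2,\dots\}$ let $P_n=(\cos(2^{-n}),\sin(2^{-n}))\in S^1$, and let $\mathcal C\subset\mathbb R^2$ be the open convex hull of $\{P_n,-P_n : n\in\mathbb N\}$. Then the limit $\lim_{R\to+\infty}\frac1R\ln[\mu_{\mathcal C}(\mathcal B_{\mathcal C}(0,R))]$ exists and equals $0$.
   Context: Let $\mathcal C\subset\mathbb R^m$ be a nonempty open bounded convex set. For distinct $p,q\in\mathcal C$, let $a,b$ be the intersection points of the straight line through $p,q$ with $\partial\mathcal C$, labelled so that $p=(1-s)a+sb$ and $q=(1-t)a+tb$ with $0<s<t<1$; the Hilbert metric is $d_{\mathcal C}(p,q)=\frac12\ln\!\big(\frac{1-s}{s}\cdot\frac{t}{1-t}\big)$, and $d_{\mathcal C}(p,p)=0$. The associated Finsler norm at $p\in\mathcal C$ is $F_{\mathcal C}(p,v)=\frac12\big(\frac1{t^-}+\frac1{t^+}\big)$ for $v\neq0$, where $t^\pm>0$ are the unique numbers with $p-t^-v\in\partial\mathcal C$ and $p+t^+v\in\partial\mathcal C$, and $F_{\mathcal C}(p,0)=0$. Let $B_{\mathcal C}(p)=\{v\in\mathbb R^m : F_{\mathcal C}(p,v)<1\}$, let $\mathrm{vol}$ be Lebesgue measure on $\mathbb R^m$ and $\omega_m$ the Lebesgue volume of the Euclidean unit ball (so $\omega_2=\pi$). The Hilbert measure is $\mu_{\mathcal C}(A)=\int_A\frac{\omega_m}{\mathrm{vol}(B_{\mathcal C}(p))}\,d\mathrm{vol}(p)$ for Borel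 $A\subset\mathcal C$. When $0\in\mathcal C$ and $R>0$, $\mathcal B_{\mathcal C}(0,R)=\{p\in\mathcal C : d_{\mathcal C}(0,p)<R\}$ denotes the open metric ball. *)

theory Defs
  imports "HOL-Analysis.Analysis"
begin

definition hilbert_dist :: "'a::euclidean_space set \<Rightarrow> 'a \<Rightarrow> 'a \<Rightarrow> real" where
  "hilbert_dist C p q =
     (if p = q then 0 else
        (THE d. \<exists>a b s t. a \<in> frontier C \<and> b \<in> frontier C \<and> 0 < s \<and> s < t \<and> t < 1 \<and>
            p = (1 - s) *\<^sub>R a + s *\<^sub>R b \<and> q = (1 - t) *\<^sub>R a + t *\<^sub>R b \<and>
            d = (1/2) * ln (((1 - s) / s) * (t / (1 - t)))))"

definition hilbert_finsler :: "'a::euclidean_space set \<Rightarrow> 'a \<Rightarrow> 'a \<Rightarrow> real" where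
  "hilbert_finsler C p v =
     (if v = 0 then 0 else
        (let tm = (THE t. 0 < t \<and> p - t *\<^sub>R v \<in> frontier C);
             tp = (THE t. 0 < t \<and> p + t *\<^sub>R v \<in> frontier C)
         in (1/2) * (1 / tm + 1 / tp)))"

definition finsler_unit_ball :: "'a::euclidean_space set \<Rightarrow> 'a \<Rightarrow> 'a set" where
  "finsler_unit_ball C p = {v. hilbert_finsler C p v < 1}"

definition hilbert_measure :: "'a::euclidean_space set \<Rightarrow> 'a set \<Rightarrow> ennreal" where
  "hilbert_measure C A =
     (\<integral>\<^sup>+ p. ennreal (measure lebesgue (ball (0::'a) 1) / measure lebesgue (finsler_unit_ball C p))
              * indicator A p \<partial>lebesgue)"

definition hilbert_ball :: "'a::euclidean_space set \<Rightarrow> 'a \<Rightarrow> real \<Rightarrow> 'a set" where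
  "hilbert_ball C x R = {p \<in> C. hilbert_dist C x p < R}"

definition P_pt :: "nat \<Rightarrow> real ^ 2" where
  "P_pt n = vector [cos (2 powr (- real n)), sin (2 powr (- real n))]"

definition C_ex :: "(real ^ 2) set" where
  "C_ex = interior (convex hull ((range P_pt) \<union> (range (\<lambda>n. - P_pt n))))"

end

theory Submission
  imports Defs "HOL-Real_Asymp.Real_Asymp"
begin

text \<open>
  If \<open>S\<close> is a neighbourhood of the origin with \<open>p + S\<close> and \<open>p - S\<close> inside \<open>C\<close> for every
  \<open>p \<in> D\<close>, then \<open>S\<close> lies in every Finsler unit ball over \<open>D\<close>; so if moreover a translate of \<open>S\<close>
  covers \<open>D\<close>, the Hilbert measure of \<open>D\<close> is at most the volume of the Euclidean unit ball.
  Two points \<open>A\<close>, \<open>B\<close> of the circle that lie in the closure of \<open>C\<close> span an inscribed rectangle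
  with vertices \<open>A\<close>, \<open>B\<close>, \<open>-A\<close>, \<open>-B\<close>. Splitting it dyadically towards its sides shows that its
  homothetic copy of ratio \<open>1 - 2 ^ (- n)\<close> has measure \<open>O(n\<^sup>2)\<close>.

  The metric ball of radius \<open>R\<close> is contained in \<open>(1 - exp (- 2 * R)) C\<close>. Take \<open>n\<close> of order \<open>R\<close>. In
  the sector of each of the first \<open>n\<close> edges, and of the long edge from \<open>P\<^sub>0\<close> to \<open>(-1, 0)\<close>, the ball
  lies in such a copy of the rectangle of that edge. The remaining edges span an angle \<open>2 ^ (- n)\<close>
  and differ from their common chord by \<open>O(4 ^ (- n))\<close>, which is below \<open>exp (- 2 * R)\<close>, so
  one more rectangle suffices. Hence the measure of the ball is \<open>O(R\<^sup>3)\<close>.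
\<close>

section \<open>Rays and the Finsler unit ball\<close>

text \<open>If \<open>t \<le> s\<close>, the frontier point would be a convex combination of two
  points of the open set \<open>C\<close>.\<close>

lemma frontier_ray_less:
  fixes C :: "'a::euclidean_space set"
  assumes "open C" "convex C" "a \<in> C" "a + s *\<^sub>R l \<in> C" "a + t *\<^sub>R l \<in> frontier C" "0 < t"
  shows "s < t"
proof (rule ccontr)
  assume "\<not> s < t"
  then have "0 < s" "t \<le> s" using assms(6) by auto
  then have "a + t *\<^sub>R l = (1 - t / s) *\<^sub>R a + (t / s) *\<^sub>R (a + s *\<^sub>R l)"
    by (simp add: algebra_simps)
  also have "\<dots> \<in> C"
    using convexD[OF assms(2,3,4), of "1 - t / s" "t / s"] \<open>0 < s\<close> \<open>t \<le> s\<close> assms(6) by simp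
  finally show False using assms(1,5) by (simp add: frontier_def interior_open)
qed

text \<open>Every point strictly between the interior point \<open>a\<close> and a point of the
  closure is interior, so the nearer of two frontier points on a ray could not be one.\<close>

lemma frontier_ray_unique:
  fixes C :: "'a::euclidean_space set"
  assumes "open C" "convex C" "a \<in> C"
    and "a + s *\<^sub>R l \<in> frontier C" "0 < s" "a + t *\<^sub>R l \<in> frontier C" "0 < t"
  shows "s = t"
proof -
  have le: "\<not> s < t" if "a + s *\<^sub>R l \<in> frontier C" "0 < s" "a + t *\<^sub>R l \<in> frontier C" for s t
  proof
    assume "s < t"
    have cl: "a + t *\<^sub>R l \<in> closure C" using that(3) by (simp add: frontier_def)
    have int: "a \<in> interior C" using assms(1,3) by (simp add: interior_open)
    have "(a + t *\<^sub>R l) - (1 - s / t) *\<^sub>R ((a + t *\<^sub>R l) - a) \<in> interior C"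
      by (rule mem_interior_closure_convex_shrink[OF assms(2) int cl])
        (use \<open>s < t\<close> that(2) in \<open>auto simp: field_simps\<close>)
    moreover have "(a + t *\<^sub>R l) - (1 - s / t) *\<^sub>R ((a + t *\<^sub>R l) - a) = a + s *\<^sub>R l"
    proof -
      have "(1 - s / t) * t = t - s" using \<open>s < t\<close> that(2) by (simp add: field_simps)
      then show ?thesis by (simp add: scaleR_diff_left)
    qed
    ultimately have "a + s *\<^sub>R l \<in> interior C" by (simp only:)
    then show False using that(1) by (simp add: frontier_def)
  qed
  show ?thesis using le[of s t] le[of t s] assms(4-7) by auto
qed

text \<open>Makes the definite descriptions in \<open>hilbert_finsler\<close> meaningful; the
  backward one is the case of \<open>- l\<close>.\<close>

lemma frontier_ray_The:
  fixes C :: "'a::euclidean_space set"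
  assumes "open C" "convex C" "bounded C" "a \<in> C" "l \<noteq> 0"
  shows "0 < (THE t. 0 < t \<and> a + t *\<^sub>R l \<in> frontier C) \<and>
         a + (THE t. 0 < t \<and> a + t *\<^sub>R l \<in> frontier C) *\<^sub>R l \<in> frontier C"
proof (rule theI')
  have "a \<in> interior C" using assms by (simp add: interior_open)
  then obtain d where "0 < d" "a + d *\<^sub>R l \<in> frontier C"
    using ray_to_frontier[OF assms(3) _ assms(5)] by blast
  then show "\<exists>!t. 0 < t \<and> a + t *\<^sub>R l \<in> frontier C"
    using frontier_ray_unique[OF assms(1,2,4)] by blast
qed

text \<open>Both exit times from \<open>p\<close> exceed 1 because \<open>p + v\<close> and
  \<open>p - v\<close> are still in \<open>C\<close>; the mean of their reciprocals is then below
  1.\<close>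

lemma hilbert_finsler_less_1:
  fixes C :: "'a::euclidean_space set"
  assumes C: "open C" "convex C" "bounded C" and p: "p \<in> C" "p + v \<in> C" "p - v \<in> C"
  shows "hilbert_finsler C p v < 1"
proof (cases "v = 0")
  case False
  define tp where "tp = (THE t. 0 < t \<and> p + t *\<^sub>R v \<in> frontier C)"
  define tm where "tm = (THE t. 0 < t \<and> p - t *\<^sub>R v \<in> frontier C)"
  have tp: "0 < tp" "p + tp *\<^sub>R v \<in> frontier C"
    using frontier_ray_The[OF C p(1) False] by (auto simp: tp_def)
  have tm: "0 < tm" "p + tm *\<^sub>R (- v) \<in> frontier C"
    using frontier_ray_The[OF C p(1), of "- v"] False by (auto simp: tm_def)
  have "1 < tp" using frontier_ray_less[OF C(1,2) p(1) _ tp(2,1), of 1] p by simp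
  moreover have "1 < tm" using frontier_ray_less[OF C(1,2) p(1) _ tm(2,1), of 1] p by simp
  ultimately have "1 / tp < 1" "1 / tm < 1" by auto
  then show ?thesis using False by (simp add: hilbert_finsler_def Let_def tp_def tm_def)
qed (simp add: hilbert_finsler_def)

section \<open>Hilbert balls of symmetric domains\<close>

text \<open>By symmetry the chord through 0 and \<open>x\<close> runs from \<open>- x\<close> to
  \<open>x\<close>, so 0 has parameter 1/2 and \<open>c *\<^sub>R x\<close> has parameter
  \<open>(1 + c) / 2\<close>. As \<open>hilbert_dist\<close> is a definite description, every
  admissible choice of \<open>a\<close>, \<open>b\<close>, \<open>s\<close>, \<open>t\<close> has to
  be traced back to this one.\<close>

lemma hilbert_dist_centre:
  fixes C :: "'a::euclidean_space set"
  assumes C: "open C" "convex C" "0 \<in> C" "\<And>x. x \<in> C \<Longrightarrow> - x \<in> C"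
    and x: "x \<in> frontier C" and c: "0 < c" "c < 1"
  shows "hilbert_dist C 0 (c *\<^sub>R x) = ln ((1 + c) / (1 - c)) / 2"
proof -
  have fm: "- y \<in> frontier C" if "y \<in> frontier C" for y
  proof -
    have "uminus ` C = C" using C(4) by (force simp: image_iff intro: bexI[of _ "- x" for x])
    then have "frontier C = uminus ` frontier C"
      using closure_scaleR[of "-1" C] interior_negations[of C]
      by (simp add: frontier_def image_set_diff inj_def)
    then show ?thesis using that by (metis image_eqI)
  qed
  have mid: "(1 - 1/2) / (1/2) * ((1 + c) / 2 / (1 - (1 + c) / 2)) = (1 + c) / (1 - c)"
  proof -
    have "1 - (1 + c) / 2 = (1 - c) / 2" by (simp add: field_simps)
    moreover have "(1 - 1/2) / (1/2) * (x / 2 / (y / 2)) = x / y" for x y :: real by simp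
    ultimately show ?thesis by metis
  qed
  have x0: "x \<noteq> 0" using x C(1,3) by (auto simp: frontier_def interior_open)
  have "(THE d. \<exists>a b s t. a \<in> frontier C \<and> b \<in> frontier C \<and> 0 < s \<and> s < t \<and> t < 1 \<and>
            0 = (1 - s) *\<^sub>R a + s *\<^sub>R b \<and> c *\<^sub>R x = (1 - t) *\<^sub>R a + t *\<^sub>R b \<and>
            d = (1/2) * ln (((1 - s) / s) * (t / (1 - t)))) = ln ((1 + c) / (1 - c)) / 2"
  proof (rule the_equality)
    show "\<exists>a b s t. a \<in> frontier C \<and> b \<in> frontier C \<and> 0 < s \<and> s < t \<and> t < 1 \<and>
            0 = (1 - s) *\<^sub>R a + s *\<^sub>R b \<and> c *\<^sub>R x = (1 - t) *\<^sub>R a + t *\<^sub>R b \<and>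
            ln ((1 + c) / (1 - c)) / 2 = (1/2) * ln (((1 - s) / s) * (t / (1 - t)))"
    proof (intro exI conjI)
      show "- x \<in> frontier C" "x \<in> frontier C" using x fm by auto
      have "c *\<^sub>R x = ((1 + c) / 2 - (1 - (1 + c) / 2)) *\<^sub>R x" by (simp add: field_simps)
      then show "c *\<^sub>R x = (1 - (1 + c) / 2) *\<^sub>R (- x) + ((1 + c) / 2) *\<^sub>R x"
        by (simp only: scaleR_diff_left scaleR_minus_right)  simp
      show "0 = (1 - 1 / 2) *\<^sub>R (- x) + (1 / 2) *\<^sub>R x" by simp
      show "ln ((1 + c) / (1 - c)) / 2 = (1/2) * ln ((1 - 1/2) / (1/2) * ((1 + c) / 2 / (1 - (1 + c) / 2)))"
        unfolding mid by simp
    qed (use c in auto)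
  next
    fix d
    assume "\<exists>a b s t. a \<in> frontier C \<and> b \<in> frontier C \<and> 0 < s \<and> s < t \<and> t < 1 \<and>
            0 = (1 - s) *\<^sub>R a + s *\<^sub>R b \<and> c *\<^sub>R x = (1 - t) *\<^sub>R a + t *\<^sub>R b \<and>
            d = (1/2) * ln (((1 - s) / s) * (t / (1 - t)))"
    then obtain a b s t where a: "a \<in> frontier C" and b: "b \<in> frontier C"
      and st: "0 < s" "s < t" "t < 1"
      and e0: "0 = (1 - s) *\<^sub>R a + s *\<^sub>R b" and e1: "c *\<^sub>R x = (1 - t) *\<^sub>R a + t *\<^sub>R b"
      and d: "d = (1/2) * ln (((1 - s) / s) * (t / (1 - t)))"
      by blast
    have ab: "a = (- s / (1 - s)) *\<^sub>R b"
    proof -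
      have "(1 - s) *\<^sub>R a = (- s) *\<^sub>R b" using e0 by (simp add: eq_neg_iff_add_eq_0)
      then have "(1 / (1 - s)) *\<^sub>R ((1 - s) *\<^sub>R a) = (1 / (1 - s)) *\<^sub>R ((- s) *\<^sub>R b)" by simp
      then show ?thesis using st by simp
    qed
    have "c *\<^sub>R x = (t - (1 - t) * s / (1 - s)) *\<^sub>R b"
      unfolding e1 ab by (simp add: algebra_simps)
    moreover have "t - (1 - t) * s / (1 - s) = (t - s) / (1 - s)"
      using st by (simp add: field_simps)
    ultimately have cx: "c *\<^sub>R x = ((t - s) / (1 - s)) *\<^sub>R b" by simp
    \<comment> \<open>\<open>s < t\<close> makes \<open>k\<close> positive, so \<open>b\<close> is
      on the ray of \<open>x\<close>, and uniqueness of the frontier point there forces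
      \<open>b = x\<close>; the opposite ray likewise forces \<open>a = - x\<close>, hence
      \<open>s = 1/2\<close>.\<close>
    define k where "k = (t - s) / (1 - s)"
    have k: "0 < k" using st by (simp add: k_def)
    have bx: "b = (c / k) *\<^sub>R x"
    proof -
      have "(1 / k) *\<^sub>R (c *\<^sub>R x) = (1 / k) *\<^sub>R (k *\<^sub>R b)" using cx by (simp add: k_def)
      then show ?thesis using k by simp
    qed
    have "c / k = 1"
      using frontier_ray_unique[OF C(1,2,3), of "c / k" x 1] b x bx k c by simp
    then have "c = k" "b = x" using bx k by auto
    have "s / (1 - s) = 1"
      using frontier_ray_unique[OF C(1,2,3), of "s / (1 - s)" "- x" 1] a fm[OF x] ab \<open>b = x\<close> st by simp
    then have s: "s = 1 / 2" using st by (simp add: field_simps)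
    then have "t = (1 + c) / 2" using \<open>c = k\<close> unfolding k_def s by (simp add: field_simps)
    then have "(1 - s) / s * (t / (1 - t)) = (1 + c) / (1 - c)" using s mid by (simp only:)
    then show "d = ln ((1 + c) / (1 - c)) / 2" using d by simp
  qed
  then show ?thesis using x0 c by (simp add: hilbert_dist_def)
qed

text \<open>For a point at the fraction \<open>c\<close> of the way to the frontier,
  \<open>1 < 1 + c < exp (2 * R) * (1 - c)\<close> gives \<open>c < 1 - exp (- 2 * R)\<close>. Since
  the closure is star-shaped about 0, the fraction can be replaced by this common ratio.\<close>

lemma hilbert_ball_centre_subset:
  fixes C :: "'a::euclidean_space set"
  assumes C: "open C" "convex C" "bounded C" "0 \<in> C" "\<And>x. x \<in> C \<Longrightarrow> - x \<in> C"
    and "0 \<le> R" and p: "p \<in> hilbert_ball C 0 R"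
  shows "\<exists>x\<in>closure C. p = (1 - exp (- 2 * R)) *\<^sub>R x"
proof (cases "p = 0")
  case True
  then show ?thesis using C(4) closure_subset by fastforce
next
  case False
  have pC: "p \<in> C" and dist: "hilbert_dist C 0 p < R" using p by (auto simp: hilbert_ball_def)
  have "0 \<in> interior C" using C by (simp add: interior_open)
  then obtain d where d: "0 < d" "0 + d *\<^sub>R p \<in> frontier C"
    using ray_to_frontier[OF C(3) _ False] by blast
  have "1 < d" using frontier_ray_less[OF C(1,2,4) _ d(2,1), of 1] pC by simp
  define c where "c = 1 / d"
  have c: "0 < c" "c < 1" using \<open>1 < d\<close> by (auto simp: c_def)
  have fr: "d *\<^sub>R p \<in> frontier C" using d by simp
  have "p = c *\<^sub>R (d *\<^sub>R p)" using d by (simp add: c_def)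
  then have "ln ((1 + c) / (1 - c)) / 2 < R"
    using hilbert_dist_centre[OF C(1,2,4,5) fr c] dist by simp
  then have "ln ((1 + c) / (1 - c)) < 2 * R" by simp
  then have lt: "(1 + c) / (1 - c) < exp (2 * R)"
    using c ln_less_cancel_iff[of "(1 + c) / (1 - c)" "exp (2 * R)"] by simp
  define l where "l = 1 - exp (- 2 * R)"
  have E: "exp (- 2 * R) = 1 / exp (2 * R)" by (simp add: exp_minus field_simps)
  have "1 + c < exp (2 * R) * (1 - c)" using lt c by (simp add: field_simps)
  then have "1 < exp (2 * R) * (1 - c)" using c by linarith
  then have cl: "c < l" unfolding l_def E by (simp add: field_simps)
  have l: "0 < l" using cl c by simp
  have "(1 - c / l) *\<^sub>R 0 + (c / l) *\<^sub>R (d *\<^sub>R p) \<in> closure C"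
    using cl c l fr C(4) closure_subset
    by (intro convexD[OF convex_closure[OF C(2)]]) (auto simp: frontier_def)
  moreover have "p = l *\<^sub>R ((1 - c / l) *\<^sub>R 0 + (c / l) *\<^sub>R (d *\<^sub>R p))"
    using l d by (simp add: c_def)
  ultimately show ?thesis unfolding l_def by blast
qed

section \<open>Majorizing the Hilbert density\<close>

text \<open>The integral of a nonmeasurable function is a lower integral and not subadditive, so unions
  are handled through measurable majorants; the measurability of the Hilbert density is never needed.\<close>

definition hilbert_majorized :: "'a::euclidean_space set \<Rightarrow> 'a set \<Rightarrow> real \<Rightarrow> bool" where
  "hilbert_majorized C D b \<longleftrightarrow>
     (\<exists>g\<in>borel_measurable lebesgue.
        (\<forall>p\<in>D. ennreal (measure lebesgue (ball (0::'a) 1) / measure lebesgue (finsler_unit_ball C p)) \<le> g p)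
        \<and> (\<integral>\<^sup>+ p. g p \<partial>lebesgue) \<le> ennreal b)"

lemma hilbert_majorizedD:
  assumes "hilbert_majorized C D b"
  shows "hilbert_measure C D \<le> ennreal b"
proof -
  obtain g where g: "\<forall>p\<in>D. ennreal (measure lebesgue (ball (0::'a) 1) / measure lebesgue (finsler_unit_ball C p)) \<le> g p"
    "(\<integral>\<^sup>+ p. g p \<partial>lebesgue) \<le> ennreal b"
    using assms by (auto simp: hilbert_majorized_def)
  have "hilbert_measure C D \<le> (\<integral>\<^sup>+ p. g p \<partial>lebesgue)"
    unfolding hilbert_measure_def using g(1)
    by (intro nn_integral_mono) (auto simp: indicator_def)
  with g(2) show ?thesis by order
qed

lemma hilbert_majorized_subset:
  "hilbert_majorized C D b \<Longrightarrow> D' \<subseteq> D \<Longrightarrow> hilbert_majorized C D' b"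
  unfolding hilbert_majorized_def by blast

text \<open>At a point of \<open>D i\<close> the nonnegative sum dominates the single majorant
  \<open>g i\<close>, and measurability of the majorants makes the integral additive.\<close>

lemma hilbert_majorized_UN:
  fixes C :: "'a::euclidean_space set"
  assumes "finite I" and "0 \<le> b" and D: "\<And>i. i \<in> I \<Longrightarrow> hilbert_majorized C (D i) b"
  shows "hilbert_majorized C (\<Union>i\<in>I. D i) (real (card I) * b)"
proof -
  let ?den = "\<lambda>p. ennreal (measure lebesgue (ball (0::'a) 1) / measure lebesgue (finsler_unit_ball C p))"
  obtain g where g: "\<And>i. i \<in> I \<Longrightarrow> g i \<in> borel_measurable lebesgue"
    "\<And>i p. i \<in> I \<Longrightarrow> p \<in> D i \<Longrightarrow> ?den p \<le> g i p"
    "\<And>i. i \<in> I \<Longrightarrow> (\<integral>\<^sup>+ p. g i p \<partial>lebesgue) \<le> ennreal b"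
    using D unfolding hilbert_majorized_def by metis
  show ?thesis
    unfolding hilbert_majorized_def
  proof (intro bexI[of _ "\<lambda>p. \<Sum>i\<in>I. g i p"] conjI ballI)
    fix p assume "p \<in> (\<Union>i\<in>I. D i)"
    then obtain i where i: "i \<in> I" "p \<in> D i" by blast
    have "?den p \<le> g i p" using g(2) i by blast
    also have "\<dots> \<le> (\<Sum>i\<in>I. g i p)" using assms(1) i(1) by (intro member_le_sum) auto
    finally show "?den p \<le> (\<Sum>i\<in>I. g i p)" .
  next
    have "(\<integral>\<^sup>+ p. (\<Sum>i\<in>I. g i p) \<partial>lebesgue) = (\<Sum>i\<in>I. \<integral>\<^sup>+ p. g i p \<partial>lebesgue)"
      using g(1) by (rule nn_integral_sum)
    also have "\<dots> \<le> (\<Sum>i\<in>I. ennreal b)" using g(3) by (intro sum_mono) auto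
    also have "\<dots> = ennreal (real (card I) * b)"
      using assms(2) by (simp add: ennreal_mult ennreal_of_nat_eq_real_of_nat)
    finally show "(\<integral>\<^sup>+ p. (\<Sum>i\<in>I. g i p) \<partial>lebesgue) \<le> ennreal (real (card I) * b)" .
  qed (use g(1) in auto)
qed

text \<open>On \<open>D\<close> the density is at most the volume of the Euclidean unit ball divided
  by that of \<open>S\<close>, and \<open>D\<close> lies in a translate of \<open>S\<close>. The
  volume of \<open>S\<close> cancels, so all cells get the same bound, however thin.\<close>

lemma hilbert_majorized_cell:
  fixes C :: "'a::euclidean_space set"
  assumes C: "open C" "convex C" "bounded C"
    and S: "open S" "bounded S" "0 \<in> S"
    and D: "\<And>p. p \<in> D \<Longrightarrow> p - q \<in> S"
    and DS: "\<And>p v. p \<in> D \<Longrightarrow> v \<in> S \<Longrightarrow> p + v \<in> C \<and> p - v \<in> C"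
  shows "hilbert_majorized C D (measure lebesgue (ball (0::'a) 1))"
proof -
  let ?w = "measure lebesgue (ball (0::'a) 1)"
  have Sm: "S \<in> lmeasurable" using S by (intro lmeasurable_open)
  have "0 < measure lebesgue S"
  proof -
    have "\<not> negligible S" using S open_not_negligible by blast
    then show ?thesis using Sm by (simp add: negligible_iff_measure zero_less_measure_iff)
  qed
  define g where "g = (\<lambda>p. ennreal (?w / measure lebesgue S) * indicator ((+) q ` S) p)"
  have qS: "(+) q ` S \<in> lmeasurable" using Sm by (rule measurable_translation)
  have "?w / measure lebesgue (finsler_unit_ball C p) \<le> ?w / measure lebesgue S" if "p \<in> D" for p
  proof (cases "finsler_unit_ball C p \<in> lmeasurable")
    case True
    have "p \<in> C" using DS[OF that S(3)] by simp
    then have "S \<subseteq> finsler_unit_ball C p"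
      using DS[OF that] hilbert_finsler_less_1[OF C] by (auto simp: finsler_unit_ball_def)
    then have "measure lebesgue S \<le> measure lebesgue (finsler_unit_ball C p)"
      using True Sm by (intro measure_mono_fmeasurable) auto
    then show ?thesis using \<open>0 < measure lebesgue S\<close> by (intro divide_left_mono) auto
  next
    case False \<comment> \<open>\<^const>\<open>measure\<close> is then 0, and so is the quotient\<close>
    then have "finsler_unit_ball C p \<notin> sets lebesgue \<or> emeasure lebesgue (finsler_unit_ball C p) = top"
      by (auto simp: fmeasurable_def simp del: emeasure_completion simp flip: top.not_eq_extremum) 
    then have "measure lebesgue (finsler_unit_ball C p) = 0"
      by (elim disjE) (simp add: measure_notin_sets, simp add: measure_def del: emeasure_completion)
    then show ?thesis by simp
  qed
  moreover have "p \<in> (+) q ` S" if "p \<in> D" for p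
    using D[OF that] by (intro image_eqI[of _ _ "p - q"]) auto
  ultimately have le: "ennreal (?w / measure lebesgue (finsler_unit_ball C p)) \<le> g p" if "p \<in> D" for p
    using that by (simp add: g_def ennreal_leI)
  have "(\<integral>\<^sup>+ p. g p \<partial>lebesgue) = ennreal (?w / measure lebesgue S) * emeasure lebesgue ((+) q ` S)"
    unfolding g_def using qS by (intro nn_integral_cmult_indicator) auto
  also have "\<dots> = ennreal (?w / measure lebesgue S) * ennreal (measure lebesgue S)"
    using qS by (simp add: emeasure_eq_measure2 measure_translation)
  also have "\<dots> = ennreal ?w"
    using \<open>0 < measure lebesgue S\<close> by (simp flip: ennreal_mult)
  finally show ?thesis
    unfolding hilbert_majorized_def using le qS
    by (intro bexI[of _ g]) (auto simp: g_def)
qed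

section \<open>Rectangles inscribed in the unit circle\<close>

definition dir :: "real \<Rightarrow> real ^ 2" where
  "dir \<theta> = vector [cos \<theta>, sin \<theta>]"

lemma inner_dir: "dir \<alpha> \<bullet> dir \<beta> = cos (\<alpha> - \<beta>)"
  by (simp add: dir_def inner_vec_def sum_2 vector_2 cos_diff)

lemma norm_dir [simp]: "norm (dir \<theta>) = 1"
  by (simp add: norm_eq_sqrt_inner inner_dir)

lemma dir_expand: "(p \<bullet> dir m) *\<^sub>R dir m + (p \<bullet> dir (m + pi/2)) *\<^sub>R dir (m + pi/2) = p"
proof -
  have "(x * c + y * s) * c - (y * c - x * s) * s = x" "(x * c + y * s) * s + (y * c - x * s) * c = y"
    if "c\<^sup>2 + s\<^sup>2 = 1" for x y c s :: real
    using that by algebra+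
  from this[of "cos m" "sin m"] show ?thesis
    by (simp add: vec_eq_iff forall_2 dir_def inner_vec_def sum_2 vector_2 cos_add sin_add)
qed

lemma dir_half_sum:
  "cos h *\<^sub>R dir m = (1/2) *\<^sub>R (dir (m + h) + dir (m - h))"
  "sin h *\<^sub>R dir (m + pi/2) = (1/2) *\<^sub>R (dir (m + h) - dir (m - h))"
  by (simp_all add: vec_eq_iff forall_2 dir_def vector_2 cos_add sin_add cos_diff sin_diff)

text \<open>The half sides \<open>cos h\<close> and \<open>sin h\<close> along the axes
  \<open>dir m\<close> and \<open>dir (m + pi/2)\<close> describe the rectangle with vertices
  \<open>dir (m + h)\<close>, \<open>dir (m - h)\<close> and their negatives.\<close>

lemma rectangle_subset_convex:
  assumes H: "convex H" and A: "dir (m + h) \<in> H" "- dir (m + h) \<in> H"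
    and B: "dir (m - h) \<in> H" "- dir (m - h) \<in> H"
    and p: "\<bar>p \<bullet> dir m\<bar> < cos h" "\<bar>p \<bullet> dir (m + pi/2)\<bar> < sin h"
  shows "p \<in> H"
proof -
  define u where "u = (p \<bullet> dir m) / cos h"
  define w where "w = (p \<bullet> dir (m + pi/2)) / sin h"
  have pos: "0 < cos h" "0 < sin h" using p by linarith+
  have u: "\<bar>u\<bar> < 1" and w: "\<bar>w\<bar> < 1" using p pos by (auto simp: u_def w_def)
  \<comment> \<open>\<open>Q\<close> and \<open>Q'\<close> are on the two sides orthogonal to
    \<open>dir m\<close>, at the height of \<open>p\<close>, and \<open>p\<close> is between
    them.\<close>
  define Q where "Q = ((1 + w) / 2) *\<^sub>R dir (m + h) + ((1 - w) / 2) *\<^sub>R dir (m - h)"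
  define Q' where "Q' = ((1 + w) / 2) *\<^sub>R - dir (m - h) + ((1 - w) / 2) *\<^sub>R - dir (m + h)"
  have "Q \<in> H" "Q' \<in> H" unfolding Q_def Q'_def
    using w by (intro convexD[OF H] A B; simp add: field_simps)+
  then have "((1 + u) / 2) *\<^sub>R Q + ((1 - u) / 2) *\<^sub>R Q' \<in> H"
    using u by (intro convexD[OF H]) (simp_all add: field_simps)
  moreover have "((1 + u) / 2) *\<^sub>R Q + ((1 - u) / 2) *\<^sub>R Q' =
      u *\<^sub>R (1/2) *\<^sub>R (dir (m + h) + dir (m - h)) + w *\<^sub>R (1/2) *\<^sub>R (dir (m + h) - dir (m - h))"
    unfolding Q_def Q'_def by (simp add: vec_eq_iff field_simps)
  moreover have "\<dots> = p"
    unfolding dir_half_sum[symmetric] using pos dir_expand[of p m] by (simp add: u_def w_def)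
  ultimately show ?thesis by simp
qed

lemma dyadic_scale:
  fixes x :: real
  assumes "(1/2) ^ n \<le> x" "x \<le> 1" "0 < n"
  shows "\<exists>i<n. (1/2) ^ Suc i \<le> x \<and> x \<le> (1/2) ^ i"
  using assms
proof (induction n)
  case (Suc n)
  show ?case
  proof (cases "(1/2) ^ n \<le> x")
    case True
    show ?thesis
    proof (cases "n = 0")
      case True
      then show ?thesis using Suc.prems by auto
    next
      case False
      then show ?thesis using Suc.IH[OF True Suc.prems(2)] by (auto intro: less_SucI)
    qed
  next
    case False
    then show ?thesis using Suc.prems by (intro exI[of _ n]) auto
  qed
qed simp

text \<open>\<open>3/4 * r\<close> is the midpoint of \<open>r / 2\<close> and \<open>r\<close>, so
  the deviation is at most \<open>r / 4 * a\<close>, strictly less than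
  \<open>r / 2 * a\<close>.\<close>

lemma dyadic_cell:
  fixes x a r :: real and \<sigma> :: real
  assumes "0 < a" and "\<sigma> = 1 \<or> \<sigma> = -1" and "\<sigma> * x = \<bar>x\<bar>"
    and "r / 2 * a \<le> a - \<bar>x\<bar>" "a - \<bar>x\<bar> \<le> r * a" "0 < r"
  shows "\<bar>x - \<sigma> * (1 - 3/4 * r) * a\<bar> < r / 2 * a"
proof -
  have "x = \<sigma> * \<bar>x\<bar>" using assms(2,3) by auto
  then have "x - \<sigma> * (1 - 3/4 * r) * a = \<sigma> * (\<bar>x\<bar> - (a - 3/4 * (r * a)))"
    by (simp add: algebra_simps)
  then have "\<bar>x - \<sigma> * (1 - 3/4 * r) * a\<bar> = \<bar>\<bar>x\<bar> - (a - 3/4 * (r * a))\<bar>"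
    using assms(2) by (auto simp: abs_mult)
  moreover have "0 < r * a" using assms by simp
  ultimately show ?thesis using assms(4,5) by linarith
qed

text \<open>Cells are sorted by the relative distance to the sides, in powers of 1/2. Two signs and
  \<open>n\<close> scales per coordinate give \<open>4 * real n ^ 2\<close> cells.\<close>

lemma hilbert_majorized_rectangle:
  fixes C :: "(real ^ 2) set"
  assumes C: "open C" "convex C" "bounded C" and "0 < a" "0 < b" "0 < n"
    and K: "\<And>p. \<bar>p \<bullet> dir m\<bar> < a \<Longrightarrow> \<bar>p \<bullet> dir (m + pi/2)\<bar> < b \<Longrightarrow> p \<in> C"
  shows "hilbert_majorized C
      {p. \<bar>p \<bullet> dir m\<bar> \<le> (1 - (1/2) ^ n) * a \<and> \<bar>p \<bullet> dir (m + pi/2)\<bar> \<le> (1 - (1/2) ^ n) * b}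
      (4 * real n ^ 2 * measure lebesgue (ball (0 :: real ^ 2) 1))"
proof -
  let ?e = "dir m" and ?f = "dir (m + pi/2)"
  let ?I = "{1, -1::real} \<times> {1, -1::real} \<times> {..<n} \<times> {..<n}"
  define D where "D = (\<lambda>(\<sigma>, \<tau>, i, j).
     {p. \<sigma> * (p \<bullet> ?e) = \<bar>p \<bullet> ?e\<bar> \<and> (1/2) ^ Suc i * a \<le> a - \<bar>p \<bullet> ?e\<bar> \<and> a - \<bar>p \<bullet> ?e\<bar> \<le> (1/2) ^ i * a \<and>
         \<tau> * (p \<bullet> ?f) = \<bar>p \<bullet> ?f\<bar> \<and> (1/2) ^ Suc j * b \<le> b - \<bar>p \<bullet> ?f\<bar> \<and> b - \<bar>p \<bullet> ?f\<bar> \<le> (1/2) ^ j * b})"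
  have ef: "?e \<bullet> ?e = 1" "?f \<bullet> ?f = 1" "?e \<bullet> ?f = 0" "?f \<bullet> ?e = 0"
    by (simp_all add: inner_dir)
  have cell: "hilbert_majorized C (D (\<sigma>, \<tau>, i, j)) (measure lebesgue (ball (0 :: real ^ 2) 1))"
    if \<sigma>: "\<sigma> = 1 \<or> \<sigma> = -1" and \<tau>: "\<tau> = 1 \<or> \<tau> = -1" for \<sigma> \<tau> i j
  proof -
    \<comment> \<open>The half sides of \<open>S\<close> are the least distances allowed between the
      cell and the sides of the rectangle, so \<open>p + S\<close> and \<open>p - S\<close> stay
      inside. They are twice the half sides of the cell, so the translate of \<open>S\<close> to its
      centre \<open>q\<close> covers it.\<close>
    define S where "S = {v. \<bar>v \<bullet> ?e\<bar> < (1/2) ^ i / 2 * a \<and> \<bar>v \<bullet> ?f\<bar> < (1/2) ^ j / 2 * b}"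
    define q where "q = (\<sigma> * (1 - 3/4 * (1/2) ^ i) * a) *\<^sub>R ?e + (\<tau> * (1 - 3/4 * (1/2) ^ j) * b) *\<^sub>R ?f"
    show ?thesis
    proof (rule hilbert_majorized_cell[OF C, of S _ q])
      show "open S" unfolding S_def by (intro open_Collect_conj open_Collect_less continuous_intros)
      show "0 \<in> S" using assms by (simp add: S_def)
      show "bounded S"
      proof (rule boundedI)
        fix v assume "v \<in> S"
        have "norm v \<le> \<bar>v \<bullet> ?e\<bar> + \<bar>v \<bullet> ?f\<bar>"
          using norm_triangle_ineq[of "(v \<bullet> ?e) *\<^sub>R ?e" "(v \<bullet> ?f) *\<^sub>R ?f"] by (simp add: dir_expand)
        then show "norm v \<le> (1/2) ^ i / 2 * a + (1/2) ^ j / 2 * b"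
          using \<open>v \<in> S\<close> by (simp add: S_def)
      qed
    next
      fix p assume "p \<in> D (\<sigma>, \<tau>, i, j)"
      then have p: "\<sigma> * (p \<bullet> ?e) = \<bar>p \<bullet> ?e\<bar>" "(1/2) ^ i / 2 * a \<le> a - \<bar>p \<bullet> ?e\<bar>" "a - \<bar>p \<bullet> ?e\<bar> \<le> (1/2) ^ i * a"
         "\<tau> * (p \<bullet> ?f) = \<bar>p \<bullet> ?f\<bar>" "(1/2) ^ j / 2 * b \<le> b - \<bar>p \<bullet> ?f\<bar>" "b - \<bar>p \<bullet> ?f\<bar> \<le> (1/2) ^ j * b"
        by (simp_all add: D_def)
      show "p - q \<in> S"
        using dyadic_cell[OF \<open>0 < a\<close> \<sigma> p(1-3)] dyadic_cell[OF \<open>0 < b\<close> \<tau> p(4-6)]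
        by (simp add: S_def q_def inner_diff_left inner_add_left ef)
      fix v assume "v \<in> S"
      then show "p + v \<in> C \<and> p - v \<in> C"
        using p by (auto intro!: K simp: S_def inner_diff_left inner_add_left)
    qed
  qed
  have "hilbert_majorized C (\<Union>x\<in>?I. D x) (real (card ?I) * measure lebesgue (ball (0 :: real ^ 2) 1))"
    by (rule hilbert_majorized_UN) (use cell in auto)
  moreover have "real (card ?I) = 4 * real n ^ 2"
    by (simp add: card_cartesian_product power2_eq_square)
  moreover have "{p. \<bar>p \<bullet> ?e\<bar> \<le> (1 - (1/2) ^ n) * a \<and> \<bar>p \<bullet> ?f\<bar> \<le> (1 - (1/2) ^ n) * b} \<subseteq> (\<Union>x\<in>?I. D x)"
  proof
    have sc: "\<exists>i<n. (1/2) ^ Suc i * c \<le> c - \<bar>x\<bar> \<and> c - \<bar>x\<bar> \<le> (1/2) ^ i * c"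
      if "0 < c" "\<bar>x\<bar> \<le> (1 - (1/2) ^ n) * c" for x c :: real
    proof -
      have "\<exists>i<n. (1/2) ^ Suc i \<le> (c - \<bar>x\<bar>) / c \<and> (c - \<bar>x\<bar>) / c \<le> (1/2) ^ i"
        using that \<open>0 < n\<close> by (intro dyadic_scale) (auto simp: field_simps)
      then show ?thesis using that(1) by (simp only: pos_le_divide_eq pos_divide_le_eq)
    qed
    have sg: "\<exists>\<sigma>\<in>{1, -1}. \<sigma> * x = \<bar>x\<bar>" for x :: real by (cases "0 \<le> x") auto
    fix p assume "p \<in> {p. \<bar>p \<bullet> ?e\<bar> \<le> (1 - (1/2) ^ n) * a \<and> \<bar>p \<bullet> ?f\<bar> \<le> (1 - (1/2) ^ n) * b}"
    then obtain i j where "i < n" "(1/2) ^ Suc i * a \<le> a - \<bar>p \<bullet> ?e\<bar> \<and> a - \<bar>p \<bullet> ?e\<bar> \<le> (1/2) ^ i * a"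
      "j < n" "(1/2) ^ Suc j * b \<le> b - \<bar>p \<bullet> ?f\<bar> \<and> b - \<bar>p \<bullet> ?f\<bar> \<le> (1/2) ^ j * b"
      using sc[of a "p \<bullet> ?e"] sc[of b "p \<bullet> ?f"] assms(4,5) by blast
    moreover obtain \<sigma> \<tau> where "\<sigma> \<in> {1, -1}" "\<sigma> * (p \<bullet> ?e) = \<bar>p \<bullet> ?e\<bar>" "\<tau> \<in> {1, -1}" "\<tau> * (p \<bullet> ?f) = \<bar>p \<bullet> ?f\<bar>"
      using sg by meson
    ultimately have "p \<in> D (\<sigma>, \<tau>, i, j)" "(\<sigma>, \<tau>, i, j) \<in> ?I" by (simp_all add: D_def)
    then show "p \<in> (\<Union>x\<in>?I. D x)" by blast
  qed
  ultimately show ?thesis by (metis (no_types, lifting) hilbert_majorized_subset)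
qed


section \<open>The domain\<close>

text \<open>The closure adds the limits \<open>dir 0\<close> and \<open>- dir 0\<close> of the
  vertices, which are needed as corners of rectangles, and leaves the interior unchanged.\<close>

definition P_hull :: "(real ^ 2) set" where
  "P_hull = closure (convex hull (range P_pt \<union> range (\<lambda>n. - P_pt n)))"

lemma P_pt_eq_dir: "P_pt n = dir ((1/2) ^ n)"
  by (simp add: P_pt_def dir_def powr_minus powr_realpow power_one_over inverse_eq_divide)

lemma convex_P_hull: "convex P_hull"
  by (simp add: P_hull_def convex_closure)

lemma C_ex_eq: "C_ex = interior P_hull"
  by (simp add: C_ex_def P_hull_def convex_interior_closure)

lemma uminus_P_hull: "x \<in> P_hull \<Longrightarrow> - x \<in> P_hull"
proof -
  let ?V = "range P_pt \<union> range (\<lambda>n. - P_pt n)"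
  have "uminus ` ?V = ?V" by (auto simp: image_Un image_image)
  then have "uminus ` P_hull = P_hull"
    unfolding P_hull_def using closure_scaleR[of "-1" "convex hull ?V"] convex_hull_scaling[of "-1" ?V]
    by simp
  then show "x \<in> P_hull \<Longrightarrow> - x \<in> P_hull" by blast
qed

lemma open_C_ex: "open C_ex" and convex_C_ex: "convex C_ex" and bounded_C_ex: "bounded C_ex"
proof -
  show "open C_ex" "convex C_ex" by (simp_all add: C_ex_def convex_interior)
  have "bounded (range P_pt \<union> range (\<lambda>n. - P_pt n))"
    by (rule boundedI[of _ 1]) (auto simp: P_pt_eq_dir)
  then show "bounded C_ex"
    unfolding C_ex_def by (intro bounded_interior bounded_convex_hull)
qed

lemma uminus_C_ex: "x \<in> C_ex \<Longrightarrow> - x \<in> C_ex"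
proof -
  have "uminus ` P_hull = P_hull"
    using uminus_P_hull by (force simp: image_iff intro: bexI[of _ "- x" for x])
  then have "uminus ` C_ex = C_ex" unfolding C_ex_eq by (metis interior_negations)
  then show "x \<in> C_ex \<Longrightarrow> - x \<in> C_ex" by blast
qed

lemma closure_C_ex_subset: "closure C_ex \<subseteq> P_hull"
  unfolding C_ex_eq by (intro closure_minimal interior_subset) (simp add: P_hull_def)

lemma dir_power_in_P_hull: "dir ((1/2) ^ n) \<in> P_hull"
  unfolding P_hull_def P_pt_eq_dir[symmetric]
  using closure_subset hull_subset by (metis (no_types, lifting) UnI1 rangeI subsetD)

lemma dir_0_in_P_hull: "dir 0 \<in> P_hull"
proof -
  have "(\<lambda>n. (1/2::real) ^ n) \<longlonglongrightarrow> 0" by (rule LIMSEQ_realpow_zero) auto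
  then have cs: "(\<lambda>n. cos ((1/2::real) ^ n)) \<longlonglongrightarrow> cos 0" "(\<lambda>n. sin ((1/2::real) ^ n)) \<longlonglongrightarrow> sin 0"
    using tendsto_cos tendsto_sin by blast+
  have "(\<lambda>n. dir ((1/2) ^ n)) \<longlonglongrightarrow> dir 0"
  proof (rule vec_tendstoI)
    fix i :: 2
    show "(\<lambda>n. dir ((1/2) ^ n) $ i) \<longlonglongrightarrow> dir 0 $ i"
      using cs exhaust_2[of i] by (auto simp: dir_def)
  qed
  then show ?thesis
    using closed_sequentially[of P_hull "\<lambda>n. dir ((1/2) ^ n)" "dir 0"] dir_power_in_P_hull
    unfolding P_hull_def by blast
qed

text \<open>A closed half-plane contains the hull once it contains the vertices; the absolute value
  takes care of the negatives.\<close>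

lemma P_hull_support:
  assumes "\<And>k. \<bar>dir ((1/2) ^ k) \<bullet> e\<bar> \<le> c" and "x \<in> P_hull"
  shows "x \<bullet> e \<le> c"
proof -
  have "P_hull \<subseteq> {x. e \<bullet> x \<le> c}"
    unfolding P_hull_def
    by (intro closure_minimal hull_minimal closed_halfspace_le convex_halfspace_le)
      (use assms(1) in \<open>force simp: P_pt_eq_dir inner_commute abs_le_iff\<close>)
  then show ?thesis using assms(2) by (auto simp: inner_commute)
qed

section \<open>Sectors\<close>

text \<open>The rectangle with vertices \<open>dir lo\<close>, \<open>dir hi\<close> and their
  negatives, shrunk by the ratio \<open>1 - (1/2) ^ n\<close>; its axis is the bisector of the
  sector.\<close>

definition sector_box :: "nat \<Rightarrow> real \<Rightarrow> real \<Rightarrow> (real ^ 2) set" where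
  "sector_box n lo hi = {p. \<bar>p \<bullet> dir ((lo + hi) / 2)\<bar> \<le> (1 - (1/2) ^ n) * cos ((hi - lo) / 2) \<and>
     \<bar>p \<bullet> dir ((lo + hi) / 2 + pi/2)\<bar> \<le> (1 - (1/2) ^ n) * sin ((hi - lo) / 2)}"

lemma rectangle_subset_C_ex:
  assumes "dir lo \<in> P_hull" "dir hi \<in> P_hull"
    and "\<bar>p \<bullet> dir ((lo + hi) / 2)\<bar> < cos ((hi - lo) / 2)"
    and "\<bar>p \<bullet> dir ((lo + hi) / 2 + pi/2)\<bar> < sin ((hi - lo) / 2)"
  shows "p \<in> C_ex"
proof -
  let ?K = "{p. \<bar>p \<bullet> dir ((lo + hi) / 2)\<bar> < cos ((hi - lo) / 2) \<and>
                \<bar>p \<bullet> dir ((lo + hi) / 2 + pi/2)\<bar> < sin ((hi - lo) / 2)}"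
  have "(lo + hi) / 2 + (hi - lo) / 2 = hi" "(lo + hi) / 2 - (hi - lo) / 2 = lo"
    by (simp_all add: field_simps)
  then have "?K \<subseteq> P_hull"
    using rectangle_subset_convex[OF convex_P_hull, of "(lo + hi) / 2" "(hi - lo) / 2"]
      assms(1,2) uminus_P_hull by auto
  moreover have "open ?K" by (intro open_Collect_conj open_Collect_less continuous_intros)
  ultimately have "?K \<subseteq> C_ex" unfolding C_ex_eq by (rule interior_maximal)
  then show ?thesis using assms by blast
qed

lemma sector_majorized:
  assumes "dir lo \<in> P_hull" "dir hi \<in> P_hull" "lo < hi" "hi < lo + pi" "0 < n"
  shows "hilbert_majorized C_ex (sector_box n lo hi)
      (4 * real n ^ 2 * measure lebesgue (ball (0 :: real ^ 2) 1))"
  unfolding sector_box_def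
  by (intro hilbert_majorized_rectangle open_C_ex convex_C_ex bounded_C_ex rectangle_subset_C_ex[OF assms(1,2)]
      cos_gt_zero sin_gt_zero)
    (use assms in auto)

text \<open>Inside the sector only the side facing it matters: as
  \<open>cos h \<le> cos (\<phi> - m)\<close>, its constraint yields \<open>r \<le> c\<close>, which
  controls the other coordinate.\<close>

lemma sector_boxI:
  assumes "0 \<le> r" "lo \<le> \<phi>" "\<phi> \<le> hi" "lo < hi" "hi < lo + pi"
    and "(r *\<^sub>R dir \<phi>) \<bullet> dir ((lo + hi) / 2) \<le> (1 - (1/2) ^ n) * cos ((hi - lo) / 2)"
  shows "r *\<^sub>R dir \<phi> \<in> sector_box n lo hi"
proof -
  define m h c where "m = (lo + hi) / 2" and "h = (hi - lo) / 2" and "c = 1 - (1/2::real) ^ n"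
  have h: "0 < h" "h < pi / 2" using assms by (auto simp: h_def)
  have d: "\<bar>\<phi> - m\<bar> \<le> h" using assms by (auto simp: h_def m_def abs_le_iff field_simps)
  have cos: "cos h \<le> cos (\<phi> - m)"
    using cos_monotone_0_pi_le[of "\<bar>\<phi> - m\<bar>" h] d h by simp
  have sin: "\<bar>sin (\<phi> - m)\<bar> \<le> sin h"
    using sin_monotone_2pi_le[of "\<phi> - m" h] sin_monotone_2pi_le[of "- h" "\<phi> - m"] d h
    by (auto simp: abs_le_iff)
  have "0 < cos h" "0 < sin h" using h by (auto intro: cos_gt_zero sin_gt_zero)
  have le: "r * cos (\<phi> - m) \<le> c * cos h" using assms(6) by (simp add: inner_dir m_def h_def c_def)
  have "r * cos h \<le> c * cos h" using mult_left_mono[OF cos assms(1)] le by linarith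
  then have "r \<le> c" using \<open>0 < cos h\<close> by simp
  then have "r * \<bar>sin (\<phi> - m)\<bar> \<le> c * sin h"
    using sin assms(1) \<open>0 < sin h\<close> by (intro mult_mono) auto
  moreover have "cos (\<phi> - (m + pi / 2)) = sin (\<phi> - m)"
    by (simp add: cos_diff sin_diff cos_add sin_add)
  moreover have "0 \<le> r * cos (\<phi> - m)" using assms(1) cos \<open>0 < cos h\<close> by simp
  ultimately show ?thesis
    using le assms(1) by (simp add: sector_box_def inner_dir abs_mult flip: m_def h_def c_def)
qed

lemma sector_box_uminus: "- p \<in> sector_box n lo hi \<longleftrightarrow> p \<in> sector_box n lo hi"
  by (simp add: sector_box_def)

lemma abs_cos_le:
  fixes h x :: real
  assumes "0 \<le> h" "h \<le> \<bar>x\<bar>" "\<bar>x\<bar> \<le> pi - h"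
  shows "\<bar>cos x\<bar> \<le> cos h"
proof -
  have "cos \<bar>x\<bar> \<le> cos h" using assms by (intro cos_monotone_0_pi_le) auto
  moreover have "cos (pi - h) \<le> cos \<bar>x\<bar>" using assms by (intro cos_monotone_0_pi_le) auto
  ultimately show ?thesis by (simp add: abs_le_iff)
qed

lemma polar_upper_half:
  fixes q :: "real ^ 2"
  assumes "0 \<le> q $ 2"
  obtains r \<phi> where "0 \<le> r" "0 \<le> \<phi>" "\<phi> \<le> pi" "q = r *\<^sub>R dir \<phi>"
proof (cases "q = 0")
  case True
  then show ?thesis using that[of 0 0] by simp
next
  case False
  define r where "r = norm q"
  have r: "0 < r" "r ^ 2 = (q $ 1) ^ 2 + (q $ 2) ^ 2"
    using False unfolding r_def power2_norm_eq_inner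
    by (simp_all add: inner_vec_def sum_2 power2_eq_square)
  have "(q $ 1 / r) ^ 2 + (q $ 2 / r) ^ 2 = 1"
    using r(1) unfolding power_divide add_divide_distrib[symmetric] r(2)[symmetric] by simp
  moreover have "0 \<le> q $ 2 / r" using assms r(1) by simp
  ultimately obtain t where t: "0 \<le> t" "t \<le> pi" "q $ 1 / r = cos t" "q $ 2 / r = sin t"
    using sincos_total_pi by blast
  have "q = r *\<^sub>R dir t"
    using r(1) by (simp add: vec_eq_iff forall_2 dir_def vector_2 flip: t(3,4))
  then show ?thesis using that[of r t] t(1,2) r(1) by simp
qed

text \<open>The vertex \<open>P\<^sub>k\<close> has angle \<open>2 ^ (- k)\<close>; up to sign, these intervals of angles cover the circle.\<close>

definition sectors :: "nat \<Rightarrow> (real \<times> real) set" where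
  "sectors n = insert (0, (1/2) ^ n) (insert (1, pi) ((\<lambda>k. ((1/2) ^ Suc k, (1/2) ^ k)) ` {..<n}))"

lemma finite_sectors: "finite (sectors n)"
  by (simp add: sectors_def)

lemma card_sectors: "card (sectors n) \<le> n + 2"
proof -
  have "card (sectors n) \<le> Suc (Suc (card ((\<lambda>k. ((1/2::real) ^ Suc k, (1/2::real) ^ k)) ` {..<n})))"
    unfolding sectors_def by (simp add: card_insert_if del: power_Suc)
  also have "card ((\<lambda>k. ((1/2::real) ^ Suc k, (1/2::real) ^ k)) ` {..<n}) \<le> n"
    using card_image_le[of "{..<n}"] by simp
  finally show ?thesis by simp
qed

lemma one_less_pi: "1 < pi"
  using pi_gt3 by linarith

text \<open>Every interval end is the angle of a point of \<open>P_hull\<close>: a vertex, the limit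
  \<open>dir 0\<close>, or \<open>dir pi = - dir 0\<close>.\<close>

lemma sectors_majorized:
  assumes "(lo, hi) \<in> sectors n" "0 < n"
  shows "hilbert_majorized C_ex (sector_box n lo hi)
      (4 * real n ^ 2 * measure lebesgue (ball (0 :: real ^ 2) 1))"
proof -
  have "dir pi = - dir 0" by (simp add: vec_eq_iff forall_2 dir_def vector_2)
  then have "dir pi \<in> P_hull" using dir_0_in_P_hull uminus_P_hull by simp
  moreover have "dir 1 \<in> P_hull" using dir_power_in_P_hull[of 0] by simp
  moreover have "(1/2::real) ^ k \<le> 1" "(0::real) < (1/2) ^ k" for k by (simp_all add: power_le_one)
  moreover have "(1/2::real) ^ k < pi" "(1/2::real) ^ k < (1/2) ^ k / 2 + pi" for k
    using one_less_pi power_le_one[of "1/2::real" k] zero_less_power[of "1/2::real" k] by linarith+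
  ultimately show ?thesis
    using assms dir_0_in_P_hull dir_power_in_P_hull dir_power_in_P_hull[of "Suc k" for k] one_less_pi
    by (intro sector_majorized) (auto simp: sectors_def)
qed

text \<open>Of the two copies of \<open>(1/2) ^ n\<close> below \<open>\<delta>\<close>, one pays
  for the shrinking of the rectangle, the other for the gap between \<open>P_hull\<close> and the
  chord of the last sector. Over the other sectors the chord is an edge and there is no gap.\<close>

lemma hilbert_ball_sector_upper:
  assumes y: "y \<in> P_hull" and q: "q = (1 - \<delta>) *\<^sub>R y" and "\<delta> \<le> 1" "2 * (1/2) ^ n \<le> \<delta>"
    and "0 \<le> q $ 2" and "0 < n"
  shows "\<exists>(lo, hi)\<in>sectors n. q \<in> sector_box n lo hi"
proof -
  define \<epsilon> where "\<epsilon> = (1/2::real) ^ n"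
  have \<epsilon>: "0 < \<epsilon>" "2 * \<epsilon> \<le> \<delta>" using assms by (auto simp: \<epsilon>_def)
  obtain r \<phi> where pol: "0 \<le> r" "0 \<le> \<phi>" "\<phi> \<le> pi" "q = r *\<^sub>R dir \<phi>"
    using polar_upper_half[OF assms(5)] .
  \<comment> \<open>\<open>far\<close> keeps all vertices and their antipodes out of the open
    sector, so the line through \<open>dir lo\<close> and \<open>dir hi\<close> supports
    \<open>P_hull\<close>.\<close>
  have in_box: "q \<in> sector_box n lo hi"
    if lh: "lo \<le> \<phi>" "\<phi> \<le> hi" "lo < hi" "hi < lo + pi"
      and far: "\<And>k. (hi - lo) / 2 \<le> \<bar>(1/2) ^ k - (lo + hi) / 2\<bar> \<and> \<bar>(1/2) ^ k - (lo + hi) / 2\<bar> \<le> pi - (hi - lo) / 2"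
    for lo hi
  proof -
    have "\<bar>dir ((1/2) ^ k) \<bullet> dir ((lo + hi) / 2)\<bar> \<le> cos ((hi - lo) / 2)" for k
      unfolding inner_dir using far[of k] lh by (intro abs_cos_le) auto
    then have "y \<bullet> dir ((lo + hi) / 2) \<le> cos ((hi - lo) / 2)" using P_hull_support y by blast
    then have "q \<bullet> dir ((lo + hi) / 2) \<le> (1 - \<delta>) * cos ((hi - lo) / 2)"
      unfolding q using \<open>\<delta> \<le> 1\<close> by (simp add: mult_left_mono)
    also have "\<dots> \<le> (1 - (1/2) ^ n) * cos ((hi - lo) / 2)"
      using \<epsilon> lh unfolding \<epsilon>_def[symmetric] by (intro mult_right_mono cos_ge_zero) auto
    finally show ?thesis using sector_boxI[OF pol(1) lh] pol(4) by simp
  qed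
  have p1: "(1/2::real) ^ k \<le> 1" "(0::real) < (1/2) ^ k" for k by (simp_all add: power_le_one)
  consider "\<phi> \<le> \<epsilon>" | "\<epsilon> \<le> \<phi>" "\<phi> \<le> 1" | "1 < \<phi>" by linarith
  then show ?thesis
  proof cases
    case 1
    have "\<epsilon> \<le> 1" by (simp add: \<epsilon>_def power_le_one)
    \<comment> \<open>Infinitely many vertices lie in this sector, so \<open>in_box\<close> does not
      apply; the bound by the unit disc is off by only
      \<open>1 - cos (\<epsilon> / 2) \<le> \<epsilon>\<close>.\<close>
    have "norm (dir ((1/2) ^ k)) * norm (dir (\<epsilon> / 2)) \<le> 1" for k by simp
    then have "\<bar>dir ((1/2) ^ k) \<bullet> dir (\<epsilon> / 2)\<bar> \<le> 1" for k
      using Cauchy_Schwarz_ineq2 order_trans by blast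
    then have "y \<bullet> dir (\<epsilon> / 2) \<le> 1" using P_hull_support y by blast
    then have "q \<bullet> dir (\<epsilon> / 2) \<le> (1 - \<delta>) * 1"
      unfolding q inner_scaleR_left using \<open>\<delta> \<le> 1\<close> by (intro mult_left_mono) auto
    also have "\<dots> \<le> 1 - 2 * \<epsilon>" using \<epsilon> by simp
    also have "\<dots> \<le> (1 - \<epsilon>) * (1 - \<epsilon>)" by (simp add: algebra_simps)
    also have "\<dots> \<le> (1 - \<epsilon>) * cos (\<epsilon> / 2)"
    proof (rule mult_left_mono)
      have "1 - cos (\<epsilon> / 2) = 2 * sin (\<epsilon> / 4) ^ 2" using cos_double_sin[of "\<epsilon> / 4"] by simp
      also have "sin (\<epsilon> / 4) ^ 2 \<le> (\<epsilon> / 4) ^ 2"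
        using sin_x_le_x[of "\<epsilon> / 4"] \<epsilon> \<open>\<epsilon> \<le> 1\<close> pi_gt3 by (intro power_mono sin_ge_zero) auto
      also have "2 * (\<epsilon> / 4) ^ 2 \<le> \<epsilon>"
        using mult_left_mono[OF \<open>\<epsilon> \<le> 1\<close>, of \<epsilon>] \<epsilon> by (simp add: power2_eq_square)
      finally show "1 - \<epsilon> \<le> cos (\<epsilon> / 2)" by simp
    qed (use \<open>\<epsilon> \<le> 1\<close> in simp)
    finally have "q \<bullet> dir (\<epsilon> / 2) \<le> (1 - \<epsilon>) * cos (\<epsilon> / 2)" .
    then have "q \<in> sector_box n 0 \<epsilon>"
      using sector_boxI[of r 0 \<phi> \<epsilon> n] pol 1 \<epsilon> \<open>\<epsilon> \<le> 1\<close> one_less_pi by (simp add: \<epsilon>_def)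
    then show ?thesis by (auto simp: sectors_def \<epsilon>_def)
  next
    case 2
    then obtain j where j: "j < n" "(1/2) ^ Suc j \<le> \<phi>" "\<phi> \<le> (1/2) ^ j"
      using dyadic_scale[of n \<phi>] assms(6) by (auto simp: \<epsilon>_def)
    define a where "a = (1/2::real) ^ j"
    have a: "0 < a" "a \<le> 1" "a / 2 \<le> \<phi>" "\<phi> \<le> a" using p1 j by (auto simp: a_def)
    have "q \<in> sector_box n (a / 2) a"
    proof (rule in_box)
      fix k
      define x where "x = (1/2::real) ^ k"
      \<comment> \<open>\<open>d\<close> is the deviation of a vertex angle from the bisector; with
        consecutive vertices at \<open>a / 2\<close> and \<open>a\<close>, it cannot be smaller than
        \<open>a / 4\<close> in size.\<close>
      define d where "d = x - (a / 2 + a) / 2"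
      have "x \<le> a / 2 \<or> a \<le> x"
        using power_decreasing[of "Suc j" k "1/2::real"] power_decreasing[of k j "1/2::real"]
        by (cases "k \<le> j") (auto simp: a_def x_def)
      moreover have "0 < x" "x \<le> 1" by (simp_all add: x_def power_le_one)
      ultimately have "d \<le> - (a / 4) \<or> a / 4 \<le> d" "- 1 \<le> d" "d \<le> 1" "(a - a / 2) / 2 = a / 4"
        using a by (auto simp: d_def)
      then show "(a - a / 2) / 2 \<le> \<bar>(1/2) ^ k - (a / 2 + a) / 2\<bar> \<and>
          \<bar>(1/2) ^ k - (a / 2 + a) / 2\<bar> \<le> pi - (a - a / 2) / 2"
        unfolding x_def[symmetric] d_def[symmetric] using a pi_gt3 by (auto simp: abs_le_iff)
    qed (use a pi_gt3 in auto)
    then have "q \<in> sector_box n ((1/2) ^ Suc j) ((1/2) ^ j)" by (simp add: a_def)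
    then show ?thesis using j(1) by (auto simp: sectors_def)
  next
    case 3
    \<comment> \<open>The vertex angles, all in \<open>(0, 1]\<close>, precede the long sector, and
      their antipodes come after \<open>pi\<close>.\<close>
    have far: "(pi - 1) / 2 \<le> \<bar>x - (1 + pi) / 2\<bar> \<and> \<bar>x - (1 + pi) / 2\<bar> \<le> pi - (pi - 1) / 2"
      if "0 < x" "x \<le> 1" for x :: real
    proof -
      define d where "d = x - (1 + pi) / 2"
      have "d \<le> - ((pi - 1) / 2)" "- ((pi + 1) / 2) \<le> d" using that by (auto simp: d_def field_simps)
      then show ?thesis unfolding d_def[symmetric] using pi_gt3 by (auto simp: abs_if field_simps)
    qed
    have "q \<in> sector_box n 1 pi"
      by (rule in_box[OF _ _ _ _ far[OF p1(2) p1(1)]]) (use 3 pol(3) pi_gt3 in auto)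
    then show ?thesis by (auto simp: sectors_def)
  qed
qed

lemma hilbert_ball_C_ex_sectors:
  assumes "0 \<le> R" "2 * (1/2) ^ n \<le> exp (- 2 * R)" "0 < n"
  shows "hilbert_ball C_ex 0 R \<subseteq> (\<Union>(lo, hi)\<in>sectors n. sector_box n lo hi)"
proof
  fix p assume p: "p \<in> hilbert_ball C_ex 0 R"
  \<comment> \<open>The open rectangle spanned by the first two vertices contains the
    origin.\<close>
  have "dir 1 \<in> P_hull" "dir (1/2) \<in> P_hull"
    using dir_power_in_P_hull[of 0] dir_power_in_P_hull[of 1] by simp_all
  then have "0 \<in> C_ex"
    using rectangle_subset_C_ex[of "1/2" 1 0] pi_gt3 by (simp add: cos_gt_zero sin_gt_zero)
  then obtain x where x: "x \<in> P_hull" "p = (1 - exp (- 2 * R)) *\<^sub>R x"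
    using hilbert_ball_centre_subset[OF open_C_ex convex_C_ex bounded_C_ex _ uminus_C_ex assms(1) p]
      closure_C_ex_subset by blast
  have e: "exp (- 2 * R) \<le> 1" using assms(1) by simp
  have "\<exists>(lo, hi)\<in>sectors n. p \<in> sector_box n lo hi"
  proof (cases "0 \<le> p $ 2")
    case True
    then show ?thesis using hilbert_ball_sector_upper[OF x e assms(2) _ assms(3)] by simp
  next
    \<comment> \<open>The lower half-plane reduces to the upper one, since \<open>P_hull\<close> and
      the boxes are centrally symmetric.\<close>
    case False
    have "- p = (1 - exp (- 2 * R)) *\<^sub>R (- x)" using x(2) by simp
    from hilbert_ball_sector_upper[OF uminus_P_hull[OF x(1)] this e assms(2) _ assms(3)] False
    show ?thesis by (simp add: sector_box_uminus)
  qed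
  then show "p \<in> (\<Union>(lo, hi)\<in>sectors n. sector_box n lo hi)" by blast
qed

section \<open>Volume growth\<close>

text \<open>At most \<open>n + 2\<close> sectors, each of measure quadratic in \<open>n\<close>,
  with \<open>n\<close> linear in \<open>R\<close>.\<close>

lemma hilbert_measure_C_ex_le:
  assumes "0 \<le> R"
  shows "hilbert_measure C_ex (hilbert_ball C_ex 0 R)
    \<le> ennreal (4 * measure lebesgue (ball (0 :: real ^ 2) 1) * (4 * R + 4) ^ 3)"
proof -
  let ?w = "measure lebesgue (ball (0 :: real ^ 2) 1)"
  \<comment> \<open>As \<open>ln 2 \<ge> 1/2\<close>, the exponent \<open>4 * R\<close> makes the
    power of 2 at least \<open>exp (2 * R)\<close>; \<open>Suc\<close> absorbs the factor 2 in
    \<open>2 * (1/2) ^ n\<close>.\<close>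
  define n where "n = Suc (nat \<lceil>4 * R\<rceil>)"
  have n: "0 < n" "4 * R + 1 \<le> real n" "real n \<le> 4 * R + 2"
    using assms by (auto simp: n_def) linarith+
  have "2 * (1/2) ^ n \<le> exp (- 2 * R)"
  proof -
    have "2 * R \<le> real (nat \<lceil>4 * R\<rceil>) * ln 2"
    proof -
      have "2 * R = (4 * R) * (1/2)" by simp
      also have "\<dots> \<le> real (nat \<lceil>4 * R\<rceil>) * ln 2"
        using ln2_ge_two_thirds n(2) assms by (intro mult_mono) (auto simp: n_def)
      finally show ?thesis .
    qed
    then have "exp (2 * R) \<le> exp (real (nat \<lceil>4 * R\<rceil>) * ln 2)" by simp
    also have "\<dots> = 2 ^ nat \<lceil>4 * R\<rceil>" by (simp add: exp_of_nat_mult)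
    finally have "exp (2 * R) \<le> 2 ^ nat \<lceil>4 * R\<rceil>" .
    then show ?thesis by (simp add: n_def power_one_over exp_minus field_simps)
  qed
  then have sub: "hilbert_ball C_ex 0 R \<subseteq> (\<Union>x\<in>sectors n. sector_box n (fst x) (snd x))"
    using hilbert_ball_C_ex_sectors[OF assms _ n(1)] by (simp add: case_prod_beta)
  have "hilbert_majorized C_ex (\<Union>x\<in>sectors n. sector_box n (fst x) (snd x))
          (real (card (sectors n)) * (4 * real n ^ 2 * ?w))"
    by (rule hilbert_majorized_UN[OF finite_sectors]) (use sectors_majorized n(1) in auto)
  then have "hilbert_measure C_ex (hilbert_ball C_ex 0 R) \<le> ennreal (real (card (sectors n)) * (4 * real n ^ 2 * ?w))"
    using sub by (intro hilbert_majorizedD) (rule hilbert_majorized_subset)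
  also have "\<dots> \<le> ennreal ((4 * R + 4) * (4 * (4 * R + 4) ^ 2 * ?w))"
  proof (intro ennreal_leI mult_mono power_mono)
    show "real (card (sectors n)) \<le> 4 * R + 4" using card_sectors[of n] n(3) by linarith
  qed (use n(3) assms in auto)
  also have "\<dots> = ennreal (4 * ?w * (4 * R + 4) ^ 3)"
    by (simp add: power2_eq_square power3_eq_cube mult_ac)
  finally show ?thesis .
qed

lemma hilbert_measure_mono: "A \<subseteq> B \<Longrightarrow> hilbert_measure C A \<le> hilbert_measure C B"
  unfolding hilbert_measure_def by (intro nn_integral_mono) (auto simp: indicator_def)

theorem theorem4p2:
  shows "((\<lambda>R. ln (enn2real (hilbert_measure C_ex (hilbert_ball C_ex 0 R))) / R) \<longlongrightarrow> 0) at_top"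
proof -
  define f where "f = (\<lambda>R. hilbert_measure C_ex (hilbert_ball C_ex 0 R))"
  define c where "c = 4 * measure lebesgue (ball (0 :: real ^ 2) 1)"
  have le: "f R \<le> ennreal (c * (4 * R + 4) ^ 3)" if "0 \<le> R" for R
    using hilbert_measure_C_ex_le[OF that] by (simp add: f_def c_def)
  have mono: "f R \<le> f R'" if "R \<le> R'" for R R'
    using that unfolding f_def by (intro hilbert_measure_mono) (auto simp: hilbert_ball_def)
  \<comment> \<open>\<open>enn2real\<close> sends \<open>top\<close> to 0, so it is monotone only
    below finite values.\<close>
  have fin: "f R < top" if "0 \<le> R" for R using le[OF that] by (simp add: le_less_trans)
  have c: "0 < c" by (simp add: c_def content_ball_pos)
  \<comment> \<open>Since \<open>f\<close> is monotone, a lower bound only needs one positive value of \<open>f\<close>; without one the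
    claim holds because \<open>ln 0 = 0\<close>.\<close>
  show ?thesis
  proof (cases "\<forall>R\<ge>0. enn2real (f R) = 0")
    case True
    have "\<forall>\<^sub>F R in at_top. ln (enn2real (f R)) / R = 0"
      using eventually_ge_at_top[of 0] by eventually_elim (use True in simp)
    then show ?thesis unfolding f_def by (rule tendsto_eventually)
  next
    case False
    then obtain r where r: "0 \<le> r" "0 < enn2real (f r)"
      by (metis enn2real_nonneg order_less_le)
    \<comment> \<open>A constant over \<open>R\<close> below and the logarithm of a cubic over
      \<open>R\<close> above, both tending to 0.\<close>
    have bounds: "ln (enn2real (f r)) / R \<le> ln (enn2real (f R)) / R \<and>
        ln (enn2real (f R)) / R \<le> ln (c * (4 * R + 4) ^ 3) / R" if R: "r \<le> R" "0 < R" for R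
    proof -
      have "enn2real (f r) \<le> enn2real (f R)"
        using mono R(1) fin[of R] R(2) by (intro enn2real_mono) auto
      moreover have "enn2real (f R) \<le> c * (4 * R + 4) ^ 3"
        using enn2real_mono[OF le[of R]] R(2) c by simp
      ultimately show ?thesis using r(2) R(2) by (auto intro!: divide_right_mono)
    qed
    show ?thesis
    proof (rule tendsto_sandwich)
      show "((\<lambda>R. ln (enn2real (f r)) / R) \<longlongrightarrow> 0) at_top" by real_asymp
      show "((\<lambda>R. ln (c * (4 * R + 4) ^ 3) / R) \<longlongrightarrow> 0) at_top" using c by real_asymp
      show "\<forall>\<^sub>F R in at_top. ln (enn2real (f r)) / R \<le> ln (enn2real (hilbert_measure C_ex (hilbert_ball C_ex 0 R))) / R"
        "\<forall>\<^sub>F R in at_top. ln (enn2real (hilbert_measure C_ex (hilbert_ball C_ex 0 R))) / R \<le> ln (c * (4 * R + 4) ^ 3) / R"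
        using eventually_ge_at_top[of "max r 1"] unfolding f_def[symmetric]
        by (eventually_elim, use bounds in \<open>simp add: f_def\<close>)+
    qed
  qed
qed

end
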